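(* Let $G$ be a connected $k$-regular graph of order $n$ and diameter $2$ with adjacency eigenvalues $k=\lambda_1\ge\lambda_2\ge\cdots\ge\lambda_n$. Then the distance Seidel eigenvalues of the extended double cover $EDC(G)$ are $-8n+4k+7$ and $2n-4k-1$ (each once), together with $7+4\lambda_r$ and $-1-4\lambda_r$ for $r=2,\dots,n$.
   Context: For a connected graph with distance matrix $\mathcal{D}$, the distance Seidel matrix is $\mathcal{D}^S=J-I-2\mathcal{D}$ ($J$ all-ones); its eigenvalues are the distance Seidel eigenvalues. For $G$ with $V(G)=\{v_1,\dots,v_n\}$, the extended double cover $EDC(G)$ is the bipartite graph with vertex set $\{v_1,\dots,v_n,u_1,\dots,u_n\}$ in which $v_r$ is adjacent to $u_r$ for each $r$, and $v_r$ is adjacent to $u_t$ whenever $v_r$ is adjacent to $v_t$ in $G$ (no other edges). *)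

theory Defs
  imports
    "Graph_Theory.Graph_Theory"
    "Jordan_Normal_Form.Char_Poly"
    "HOL-Library.Multiset"
begin

text \<open>A finite simple graph is a \<^term>\<open>pair_graph\<close>: every edge is represented
  by the two opposite arcs between its end points.\<close>

definition graph_dist :: "'a pair_pre_digraph \<Rightarrow> 'a \<Rightarrow> 'a \<Rightarrow> ereal" where
  "graph_dist G u v = wf_digraph.\<mu> (with_proj G) (\<lambda>_. 1) u v"

lemma (in pair_wf_digraph) graph_dist_eq:
  "graph_dist G u v = (INF p\<in>{p. awalk u p v}. ereal (real (length p)))"
proof -
  have "awalk_cost (\<lambda>_. 1) p = real (length p)" for p :: "('a \<times> 'a) list"
    by (induction p) (auto simp: awalk_cost_def)
  then show ?thesis
    by (simp add: graph_dist_def \<mu>_def)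
qed

definition graph_diameter :: "'a pair_pre_digraph \<Rightarrow> ereal" where
  "graph_diameter G = (SUP u\<in>pverts G. SUP v\<in>pverts G. graph_dist G u v)"

definition regular_graph :: "nat \<Rightarrow> 'a pair_pre_digraph \<Rightarrow> bool" where
  "regular_graph k G \<longleftrightarrow> (\<forall>v\<in>pverts G. out_degree (with_proj G) v = k)"

text \<open>\<^term>\<open>Inl v\<close> is the vertex $v_r$ itself and \<^term>\<open>Inr v\<close> its copy $u_r$.\<close>

definition EDC :: "'a pair_pre_digraph \<Rightarrow> ('a + 'a) pair_pre_digraph" where
  "EDC G = \<lparr> pverts = Inl ` pverts G \<union> Inr ` pverts G,
     parcs = {(Inl v, Inr v) | v. v \<in> pverts G} \<union> {(Inr v, Inl v) | v. v \<in> pverts G}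
       \<union> {(Inl v, Inr w) | v w. (v, w) \<in> parcs G}
       \<union> {(Inr w, Inl v) | v w. (v, w) \<in> parcs G} \<rparr>"

lemma pair_graph_EDC:
  assumes "pair_graph G"
  shows "pair_graph (EDC G)"
proof -
  interpret pair_graph G by fact
  have sub: "parcs (EDC G) \<subseteq> pverts (EDC G) \<times> pverts (EDC G)"
    by (auto simp: EDC_def dest: in_arcsD1 in_arcsD2)
  have fin: "finite (pverts (EDC G))"
    using pair_finite_verts by (simp add: EDC_def)
  show ?thesis
  proof unfold_locales
    show "fst e \<in> pverts (EDC G)" "snd e \<in> pverts (EDC G)" if "e \<in> parcs (EDC G)" for e
      using sub that by auto
    show "finite (pverts (EDC G))" by (fact fin)
    show "finite (parcs (EDC G))"
      using sub fin by (meson finite_SigmaI finite_subset)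
    show "symmetric (with_proj (EDC G))"
      by (auto simp: symmetric_def EDC_def intro!: symI)
    show "fst e \<noteq> snd e" if "e \<in> parcs (EDC G)" for e
      using that by (auto simp: EDC_def)
  qed
qed

text \<open>The matrices are taken with respect to a listing of the vertices.\<close>

definition enumerates :: "'a list \<Rightarrow> 'a pair_pre_digraph \<Rightarrow> bool" where
  "enumerates vs G \<longleftrightarrow> distinct vs \<and> set vs = pverts G"

definition adjacency_mat :: "'a pair_pre_digraph \<Rightarrow> 'a list \<Rightarrow> real mat" where
  "adjacency_mat G vs = mat (length vs) (length vs)
     (\<lambda>(i, j). if (vs ! i, vs ! j) \<in> parcs G then 1 else 0)"

text \<open>\<^term>\<open>real_of_ereal\<close> sends infinite distances to 0; these only occur in
  disconnected graphs.\<close>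

definition distance_mat :: "'a pair_pre_digraph \<Rightarrow> 'a list \<Rightarrow> real mat" where
  "distance_mat G vs = mat (length vs) (length vs)
     (\<lambda>(i, j). real_of_ereal (graph_dist G (vs ! i) (vs ! j)))"

definition distance_Seidel_mat :: "'a pair_pre_digraph \<Rightarrow> 'a list \<Rightarrow> real mat" where
  "distance_Seidel_mat G vs =
     mat (length vs) (length vs) (\<lambda>_. 1) - 1\<^sub>m (length vs) - 2 \<cdot>\<^sub>m distance_mat G vs"

text \<open>Eigenvalues with algebraic multiplicity. Only real roots are collected, which
  loses nothing for symmetric matrices.\<close>

definition eigenvalues :: "real mat \<Rightarrow> real multiset" where
  "eigenvalues A = proots (char_poly A)"

end

(* Since G has diameter 2, two vertices of EDC(G) on the same side are at distance 2 and
   v_r, u_t are at distance 1 or 3. With P = 3I - 3J and Q = 4I + 4A - 5J the distance Seidel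
   matrix is therefore [[P, Q], [Q, P]], whose spectrum is that of P + Q = 7I + 4A - 8J together
   with that of P - Q = -I - 4A + 2J. Regularity gives A J = k J, so adding a multiple cJ to
   aI + bA only moves the eigenvalue a + bk, to a + bk + cn: this follows from
   yI - A - sJ = (yI - A)(I - s/(y - k) J) and det (I - tJ) = 1 - nt. *)

theory Submission
  imports Defs
begin

section \<open>Determinants and characteristic polynomials of reordered, block and
  rank-one-perturbed matrices\<close>

lemma det_mat_permute:
  fixes f :: "nat \<Rightarrow> nat \<Rightarrow> 'a :: comm_ring_1"
  assumes p: "p permutes {0..<n}"
  shows "det (mat n n (\<lambda>(i, j). f (p i) (p j))) = det (mat n n (\<lambda>(i, j). f i j))"
proof -
  have lt: "p i < n" if "i < n" for i
    using permutes_in_image[OF p, of i] that by simp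
  let ?B = "mat n n (\<lambda>(i, j). f i j)"
  let ?C = "mat n n (\<lambda>(i, j). f i (p j))"
  have "mat n n (\<lambda>(i, j). f (p i) (p j)) = mat n n (\<lambda>(i, j). ?C $$ (p i, j))"
    by (rule eq_matI) (auto simp: lt)
  then have 1: "det (mat n n (\<lambda>(i, j). f (p i) (p j))) = signof p * det ?C"
    using det_permute_rows[OF _ p, of ?C] by simp
  \<comment> \<open>Columns are permuted by permuting the rows of the transpose. Rows and columns
    contribute \<open>signof p\<close> once each, and the square is 1.\<close>
  have "transpose_mat ?C = mat n n (\<lambda>(i, j). transpose_mat ?B $$ (p i, j))"
    by (rule eq_matI) (auto simp: lt)
  then have "det (transpose_mat ?C) = signof p * det (transpose_mat ?B)"
    using det_permute_rows[OF _ p, of "transpose_mat ?B"] by simp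
  then have 2: "det ?C = signof p * det ?B"
    by (simp add: det_transpose[of _ n])
  have "signof p * signof p = (1 :: 'a)"
    by (simp add: sign_def)
  with 1 2 show ?thesis
    by (simp add: mult.assoc[symmetric])
qed

text \<open>The two matrices are conjugate by a permutation matrix. This allows an arbitrary vertex
  listing of \<open>EDC G\<close> to be replaced by one that makes the block structure
  visible.\<close>

lemma char_poly_mat_reorder:
  assumes "distinct xs" "distinct ys" "set xs = set ys"
  shows "char_poly (mat (length xs) (length xs) (\<lambda>(i, j). f (xs ! i) (xs ! j)))
    = char_poly (mat (length ys) (length ys) (\<lambda>(i, j). f (ys ! i) (ys ! j)))"
proof -
  have "mset xs = mset ys"
    using assms by (simp add: set_eq_iff_mset_eq_distinct)
  then obtain p where p: "p permutes {..<length ys}" and xs: "permute_list p ys = xs"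
    by (rule mset_eq_permutation)
  define n where "n = length ys"
  have len: "length xs = n"
    using xs by (auto simp: n_def)
  have p': "p permutes {0..<n}"
    using p by (simp add: n_def atLeast0LessThan)
  have nth: "xs ! i = ys ! p i" if "i < n" for i
    using p that xs by (auto simp: permute_list_nth n_def)
  \<comment> \<open>Injectivity lets the diagonal test \<open>i = j\<close> be read as
    \<open>p i = p j\<close>, so every entry of the characteristic matrix depends on
    \<open>(p i, p j)\<close> only.\<close>
  have inj: "p i = p j \<longleftrightarrow> i = j" for i j
    using permutes_inj[OF p] by (auto dest: injD)
  have cp: "char_poly_matrix (mat n n (\<lambda>(i, j). g i j))
      = mat n n (\<lambda>(i, j). (if i = j then [:0, 1:] else 0) + [:- g i j:])" for g
    by (rule eq_matI) (auto simp: char_poly_matrix_def)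
  have "char_poly (mat n n (\<lambda>(i, j). f (xs ! i) (xs ! j)))
      = char_poly (mat n n (\<lambda>(i, j). f (ys ! p i) (ys ! p j)))"
    by (intro arg_cong[of _ _ char_poly] eq_matI) (auto simp: nth)
  also have "\<dots> = det (mat n n (\<lambda>(i, j).
      (if p i = p j then [:0, 1:] else 0) + [:- f (ys ! p i) (ys ! p j):]))"
    unfolding char_poly_def cp by (simp add: inj)
  also have "\<dots> = det (mat n n (\<lambda>(i, j).
      (if i = j then [:0, 1:] else 0) + [:- f (ys ! i) (ys ! j):]))"
    by (rule det_mat_permute[OF p'])
  also have "\<dots> = char_poly (mat n n (\<lambda>(i, j). f (ys ! i) (ys ! j)))"
    unfolding char_poly_def cp ..
  finally show ?thesis
    by (simp add: len n_def)
qed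

text \<open>Conjugating by the unimodular matrix \<open>?S\<close>, with inverse \<open>?T\<close>,
  makes the matrix block lower triangular. Unlike the conjugation that diagonalises the blocks, this
  needs no division by 2.\<close>

lemma char_poly_four_block_mat_swap:
  fixes P Q :: "'a :: idom mat"
  assumes P: "P \<in> carrier_mat n n" and Q: "Q \<in> carrier_mat n n"
  shows "char_poly (four_block_mat P Q Q P) = char_poly (P + Q) * char_poly (P - Q)"
proof -
  let ?K = "four_block_mat P Q Q P"
  let ?L = "four_block_mat (P + Q) (0\<^sub>m n n) Q (P - Q)"
  let ?S = "four_block_mat (1\<^sub>m n) (- 1\<^sub>m n) (0\<^sub>m n n) (1\<^sub>m n :: 'a mat)"
  let ?T = "four_block_mat (1\<^sub>m n) (1\<^sub>m n) (0\<^sub>m n n) (1\<^sub>m n :: 'a mat)"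
  have ST: "?S * ?T = 1\<^sub>m (n + n)" "?T * ?S = 1\<^sub>m (n + n)"
    by (subst mult_four_block_mat[of _ n n _ n _ n _ _ n _ n];
        auto intro!: eq_matI simp: uminus_l_inv_mat)+
  have LT: "?L * ?T = four_block_mat (P + Q) (P + Q) Q P"
    by (subst mult_four_block_mat[of _ n n _ n _ n _ _ n _ n])
      (use P Q in \<open>auto intro!: eq_matI\<close>)
  have "?S * ?L * ?T = ?S * (?L * ?T)"
    by (rule assoc_mult_mat[of _ "n + n" "n + n" _ "n + n" _ "n + n"])
      (use P Q in auto)
  also have "\<dots> = ?K"
    unfolding LT
    by (subst mult_four_block_mat[of _ n n _ n _ n _ _ n _ n])
      (use P Q in \<open>auto intro!: eq_matI\<close>)
  finally have "similar_mat_wit ?K ?L ?S ?T"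
    by (intro similar_mat_witI[of _ _ "n + n"] ST) (use P Q in auto)
  then have "char_poly ?K = char_poly ?L"
    by (intro char_poly_similar) (auto simp: similar_mat_def)
  also have "char_poly_matrix ?L = four_block_mat (char_poly_matrix (P + Q)) (0\<^sub>m n n)
      (map_mat (\<lambda>a. [:- a:]) Q) (char_poly_matrix (P - Q))"
    by (rule eq_matI) (use P Q in \<open>auto simp: char_poly_matrix_def\<close>)
  then have "char_poly ?L = char_poly (P + Q) * char_poly (P - Q)"
    unfolding char_poly_def
    by (simp only:, intro det_four_block_mat_upper_right_zero[of _ n _ n])
      (use P Q in \<open>auto intro: char_poly_matrix_closed minus_carrier_mat\<close>)
  finally show ?thesis .
qed

text \<open>Two block triangular factorisations of the bordered matrix with blocks
  $I$, $t\mathbf 1$, $\mathbf 1^T$, $1$ compute its determinant in both forms.\<close>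

lemma det_one_minus_const_mat:
  fixes t :: "'a :: idom"
  shows "det (mat n n (\<lambda>(i, j). (if i = j then 1 else 0) - t)) = 1 - of_nat n * t"
proof -
  let ?M = "mat n n (\<lambda>(i, j). (if i = j then 1 else 0) - t)"
  let ?u = "mat n 1 (\<lambda>_. t)" and ?v = "mat 1 n (\<lambda>_. 1 :: 'a)"
  let ?d = "mat 1 1 (\<lambda>_. 1 - of_nat n * t)"
  have "four_block_mat (1\<^sub>m n) ?u (0\<^sub>m 1 n) (1\<^sub>m 1) * four_block_mat ?M (0\<^sub>m n 1) ?v (1\<^sub>m 1)
      = four_block_mat (1\<^sub>m n) ?u ?v (1\<^sub>m 1)"
    by (subst mult_four_block_mat[of _ n n _ 1 _ 1 _ _ n _ 1])
      (auto intro!: eq_matI simp: scalar_prod_def)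
  moreover have "four_block_mat (1\<^sub>m n) (0\<^sub>m n 1) ?v (1\<^sub>m 1) * four_block_mat (1\<^sub>m n) ?u (0\<^sub>m 1 n) ?d
      = four_block_mat (1\<^sub>m n) ?u ?v (1\<^sub>m 1)"
    by (subst mult_four_block_mat[of _ n n _ 1 _ 1 _ _ n _ 1])
      (auto intro!: eq_matI simp: scalar_prod_def)
  ultimately have eq: "four_block_mat (1\<^sub>m n) ?u (0\<^sub>m 1 n) (1\<^sub>m 1) * four_block_mat ?M (0\<^sub>m n 1) ?v (1\<^sub>m 1)
      = four_block_mat (1\<^sub>m n) (0\<^sub>m n 1) ?v (1\<^sub>m 1) * four_block_mat (1\<^sub>m n) ?u (0\<^sub>m 1 n) ?d"
    by simp
  have "det (four_block_mat (1\<^sub>m n) ?u (0\<^sub>m 1 n) (1\<^sub>m 1) * four_block_mat ?M (0\<^sub>m n 1) ?v (1\<^sub>m 1)) = det ?M"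
    by (subst det_mult[of _ "n + 1"], auto)
      (subst det_four_block_mat_lower_left_zero[of _ n _ 1]
        det_four_block_mat_upper_right_zero[of _ n _ 1]; auto)+
  moreover have "det (four_block_mat (1\<^sub>m n) (0\<^sub>m n 1) ?v (1\<^sub>m 1) * four_block_mat (1\<^sub>m n) ?u (0\<^sub>m 1 n) ?d)
      = 1 - of_nat n * t"
    by (subst det_mult[of _ "n + 1"], auto)
      (subst det_four_block_mat_lower_left_zero[of _ n _ 1]
        det_four_block_mat_upper_right_zero[of _ n _ 1]; auto simp: det_single)+
  ultimately show ?thesis
    using eq by simp
qed

text \<open>Here \<open>B\<close> is aI + bA + cJ, and \<open>rows\<close> says AJ = kJ. The lemma
  is applied with (a, b, c) = (7, 4, -8) and (-1, -4, 2). The factorisation behind it divides by y -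
  k, so it is evaluated away from one point and then extended to a polynomial identity.\<close>

lemma char_poly_const_row_sum:
  fixes A :: "real mat"
  assumes A: "A \<in> carrier_mat n n"
    and rows: "\<And>i. i < n \<Longrightarrow> (\<Sum>j<n. A $$ (i, j)) = k"
    and cpA: "char_poly A = [:- k, 1:] * (\<Prod>r\<in>I. [:- ev r, 1:])"
    and I: "finite I" and b: "b \<noteq> 0"
    and B: "B = mat n n (\<lambda>(i, j). (if i = j then a else 0) + b * A $$ (i, j) + c)"
  shows "char_poly B
    = [:- (a + b * k + c * real n), 1:] * (\<Prod>r\<in>I. [:- (a + b * ev r), 1:])"
proof -
  \<comment> \<open>Comparing degrees in \<open>cpA\<close>. This later splits \<open>b ^ n\<close>
    into one factor \<open>b\<close> for each linear factor.\<close>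
  have n: "n = Suc (card I)"
  proof -
    have "degree (\<Prod>r\<in>I. [:- ev r, 1:]) = card I"
      by (subst degree_prod_eq_sum_degree) auto
    moreover have "(\<Prod>r\<in>I. [:- ev r, 1:]) \<noteq> 0"
      using I by simp
    ultimately have "degree (char_poly A) = Suc (card I)"
      unfolding cpA by (subst degree_mult_eq) auto
    then show ?thesis
      using degree_monic_char_poly[OF A] by simp
  qed
  let ?q = "[:- (a + b * k + c * real n), 1:] * (\<Prod>r\<in>I. [:- (a + b * ev r), 1:])"
  have eval: "poly (char_poly B) x = poly ?q x" if x: "x \<noteq> a + b * k" for x
  proof -
    \<comment> \<open>The choice of \<open>y\<close> gives xI - aI - bA = b(yI - A). That of
      \<open>t\<close> gives b t (y - k) = c, so that b(yI - A)(I - tJ) = xI - B.\<close>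
    define y where "y = (x - a) / b"
    define t where "t = (c / b) / (y - k)"
    have xy: "x = a + b * y" and yk: "y - k \<noteq> 0"
      using b x by (auto simp: y_def field_simps)
    let ?X = "mat n n (\<lambda>(i, j). (if i = j then y else 0) - A $$ (i, j))"
    let ?Y = "mat n n (\<lambda>(i, j). (if i = j then 1 else 0) - t)"
    have tc: "b * (t * (y - k)) = c"
      using b yk by (simp add: t_def)
    have prod: "(?X * ?Y) $$ (i, j) = (if i = j then y else 0) - A $$ (i, j) - t * (y - k)"
      if ij: "i < n" "j < n" for i j
    proof -
      have "(?X * ?Y) $$ (i, j) = (\<Sum>l<n. ((if i = l then y else 0) - A $$ (i, l))
          * ((if l = j then 1 else 0) - t))"
        using ij by (simp add: scalar_prod_def atLeast0LessThan)
      also have "\<dots> = (\<Sum>l<n. (if l = j then (if i = l then y else 0) - A $$ (i, l) else 0))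
          - t * (\<Sum>l<n. (if i = l then y else 0) - A $$ (i, l))"
        unfolding sum_distrib_left sum_subtractf[symmetric]
        by (rule sum.cong) (auto simp: algebra_simps)
      also have "(\<Sum>l<n. (if i = l then y else 0) - A $$ (i, l)) = y - k"
        using ij rows by (simp add: sum_subtractf)
      also have "(\<Sum>l<n. (if l = j then (if i = l then y else 0) - A $$ (i, l) else 0))
          = (if i = j then y else 0) - A $$ (i, j)"
        using ij by simp
      finally show ?thesis .
    qed
    \<comment> \<open>\<open>char_matrix B x\<close> stands for B - xI, hence the minus
      sign.\<close>
    have "- char_matrix B x = b \<cdot>\<^sub>m (?X * ?Y)"
    proof (rule eq_matI)
      fix i j assume "i < dim_row (b \<cdot>\<^sub>m (?X * ?Y))" "j < dim_col (b \<cdot>\<^sub>m (?X * ?Y))"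
      then have ij: "i < n" "j < n" by auto
      have "(b \<cdot>\<^sub>m (?X * ?Y)) $$ (i, j) = b * (?X * ?Y) $$ (i, j)"
        using ij by (intro index_smult_mat) auto
      also have "\<dots> = b * ((if i = j then y else 0) - A $$ (i, j)) - c"
        unfolding prod[OF ij] by (subst right_diff_distrib) (simp only: tc)
      also have "\<dots> = (- char_matrix B x) $$ (i, j)"
        using ij by (auto simp: char_matrix_def B xy algebra_simps)
      finally show "(- char_matrix B x) $$ (i, j) = (b \<cdot>\<^sub>m (?X * ?Y)) $$ (i, j)" ..
    qed (auto simp: char_matrix_def B)
    moreover have "B \<in> carrier_mat n n"
      by (simp add: B)
    ultimately have "poly (char_poly B) x = det (b \<cdot>\<^sub>m (?X * ?Y))"
      by (simp add: char_poly_matrix)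
    also have "\<dots> = b ^ n * (det ?X * det ?Y)"
      by (simp add: det_mult[of _ n])
    also have "?X = - char_matrix A y"
      by (rule eq_matI) (use A in \<open>auto simp: char_matrix_def\<close>)
    then have "det ?X = (y - k) * (\<Prod>r\<in>I. y - ev r)"
      using char_poly_matrix[OF A, of y] by (simp add: cpA poly_prod left_diff_distrib)
    also have "det ?Y = 1 - real n * t"
      by (rule det_one_minus_const_mat)
    \<comment> \<open>One factor \<open>b\<close> goes to the root belonging to \<open>k\<close>,
      where b t (y - k) = c yields the shift by cn. The other \<open>card I\<close> factors rescale
      y - \<open>ev r\<close> to x - (a + b \<open>ev r\<close>).\<close>
    also have "b ^ n * ((y - k) * (\<Prod>r\<in>I. y - ev r) * (1 - real n * t))
        = (b * (y - k) - real n * (b * (t * (y - k)))) * (b ^ card I * (\<Prod>r\<in>I. y - ev r))"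
      by (simp add: n algebra_simps)
    also have "b ^ card I * (\<Prod>r\<in>I. y - ev r) = (\<Prod>r\<in>I. x - (a + b * ev r))"
      by (simp add: prod.distrib[symmetric] xy algebra_simps flip: prod_constant)
    also have "b * (y - k) - real n * (b * (t * (y - k))) = x - (a + b * k + c * real n)"
      unfolding tc by (simp add: xy algebra_simps)
    finally show ?thesis
      by (simp add: poly_prod algebra_simps)
  qed
  \<comment> \<open>A linear factor vanishing at the excluded point makes both sides agree at every
    real number, hence as polynomials. The factor is then cancelled.\<close>
  have "[:- (a + b * k), 1:] * char_poly B = [:- (a + b * k), 1:] * ?q"
  proof (unfold poly_eq_poly_eq_iff[symmetric], rule ext)
    show "poly ([:- (a + b * k), 1:] * char_poly B) x = poly ([:- (a + b * k), 1:] * ?q) x" for x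
      unfolding poly_mult[of "[:- (a + b * k), 1:]"]
    proof (cases "x = a + b * k")
      case True
      then have "poly [:- (a + b * k), 1:] x = 0"
        by simp
      then show "poly [:- (a + b * k), 1:] x * poly (char_poly B) x
          = poly [:- (a + b * k), 1:] x * poly ?q x"
        by (simp only: mult_zero_left)
    next
      case False
      then show "poly [:- (a + b * k), 1:] x * poly (char_poly B) x
          = poly [:- (a + b * k), 1:] x * poly ?q x"
        by (intro arg_cong2[of _ _ _ _ "(*)"] eval refl)
    qed
  qed
  moreover have "[:- (a + b * k), 1:] \<noteq> 0"
    by simp
  ultimately show ?thesis
    by (rule mult_left_cancel[THEN iffD1, rotated])
qed

section \<open>Root multisets and products of linear factors\<close>

lemma proots_prod_linear:
  fixes f :: "'b \<Rightarrow> 'a :: idom"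
  assumes "finite I"
  shows "proots (\<Prod>r\<in>I. [:- f r, 1:]) = image_mset f (mset_set I)"
  using assms by (induction rule: finite_induct) (simp_all add: proots_mult del: mult_pCons_left)

text \<open>Dividing out one root keeps the polynomial monic and lowers both the degree and the
  number of roots by one. This turns the assumed list of n eigenvalues into a factorisation of the
  characteristic polynomial.\<close>

lemma eq_prod_proots:
  fixes p :: "'a :: idom poly"
  assumes "lead_coeff p = 1" and "size (proots p) = degree p"
  shows "p = (\<Prod>x\<in>#proots p. [:- x, 1:])"
  using assms
proof (induction "degree p" arbitrary: p)
  case 0
  then show ?case
    by (auto elim!: degree_eq_zeroE)
next
  case (Suc m)
  then have "proots p \<noteq> {#}"
    by auto
  then obtain x where x: "x \<in># proots p"
    by blast
  have "p \<noteq> 0"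
    using Suc.prems by auto
  then have "poly p x = 0"
    using x by simp
  then obtain q where q: "p = [:- x, 1:] * q"
    by (auto simp: poly_eq_0_iff_dvd elim: dvdE)
  have "q \<noteq> 0"
    using q \<open>p \<noteq> 0\<close> by auto
  then have pr: "proots p = add_mset x (proots q)"
    unfolding q by (subst proots_mult) (simp_all del: mult_pCons_left)
  have deg: "degree p = Suc (degree q)"
    unfolding q using \<open>q \<noteq> 0\<close> by (subst degree_mult_eq) simp_all
  have lc: "lead_coeff q = 1"
    using Suc.prems(1) unfolding q lead_coeff_mult by simp
  have "q = (\<Prod>x\<in>#proots q. [:- x, 1:])"
    using Suc.hyps(2) Suc.prems(2) pr deg lc by (intro Suc.hyps(1)) auto
  then show ?case
    unfolding pr by (simp add: q)
qed

section \<open>Distances in the extended double cover\<close>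

lemma (in pair_wf_digraph) graph_dist_eqI:
  assumes "awalk u p v" "length p = m"
    and "\<And>q. awalk u q v \<Longrightarrow> m \<le> length q"
  shows "graph_dist G u v = real m"
  unfolding graph_dist_eq
proof (rule antisym)
  show "(INF p\<in>{p. awalk u p v}. ereal (real (length p))) \<le> ereal (real m)"
    using assms by (intro INF_lower2[of p]) auto
  show "ereal (real m) \<le> (INF p\<in>{p. awalk u p v}. ereal (real (length p)))"
    using assms(3) by (intro INF_greatest) auto
qed

text \<open>If every walk had length at least 3, the infimum would be at least 3. This covers the
  case of no walk at all, where the infimum is infinite.\<close>

lemma (in pair_wf_digraph) graph_dist_le_2_cases:
  assumes "graph_dist G u v \<le> 2"
  shows "u = v \<or> (u, v) \<in> parcs G \<or> (\<exists>w. (u, w) \<in> parcs G \<and> (w, v) \<in> parcs G)"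
proof -
  have "\<exists>p. awalk u p v \<and> length p \<le> 2"
  proof (rule ccontr)
    assume "\<nexists>p. awalk u p v \<and> length p \<le> 2"
    then have "3 \<le> length p" if "awalk u p v" for p
      using that by (metis Suc_leI not_le numeral_3_eq_3 numeral_2_eq_2)
    then have "ereal 3 \<le> graph_dist G u v"
      unfolding graph_dist_eq by (intro INF_greatest) auto
    also have "\<dots> \<le> ereal 2"
      using assms by simp
    finally show False
      by simp
  qed
  then obtain p where p: "awalk u p v" "length p \<le> 2"
    by blast
  then consider "p = []" | e where "p = [e]" | e f where "p = [e, f]"
    by (cases p; cases "tl p") auto
  then show ?thesis
    using p(1) by cases (auto simp: awalk_simps)
qed

lemma parcs_EDC_iff:
  "(Inl a, Inr b) \<in> parcs (EDC G) \<longleftrightarrow> a = b \<and> a \<in> pverts G \<or> (a, b) \<in> parcs G"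
  "(Inr b, Inl a) \<in> parcs (EDC G) \<longleftrightarrow> a = b \<and> a \<in> pverts G \<or> (a, b) \<in> parcs G"
  "(Inl a, Inl c) \<notin> parcs (EDC G)" "(Inr b, Inr d) \<notin> parcs (EDC G)"
  by (auto simp: EDC_def)

text \<open>Every arc of the bipartite graph changes sides. Parity supplies the lower bounds for the
  distances below.\<close>

lemma even_length_awalk_EDC:
  assumes "pair_graph G" "pre_digraph.awalk (with_proj (EDC G)) u p v"
  shows "even (length p) \<longleftrightarrow> (isl u \<longleftrightarrow> isl v)"
proof -
  interpret H: pair_graph "EDC G"
    by (rule pair_graph_EDC) fact
  show ?thesis
    using assms(2)
  proof (induction p arbitrary: u)
    case Nil
    then show ?case by (simp add: H.awalk_simps)
  next
    case (Cons e p)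
    then have "e \<in> parcs (EDC G)" "u = fst e" "H.awalk (snd e) p v"
      by (auto simp: H.awalk_simps)
    moreover have "isl (fst e) \<noteq> isl (snd e)"
      using \<open>e \<in> parcs (EDC G)\<close> by (auto simp: EDC_def)
    ultimately show ?case
      using Cons.IH[of "snd e"] by auto
  qed
qed

context
  fixes G :: "'a pair_pre_digraph"
  assumes G: "pair_graph G" and diam: "graph_diameter G \<le> 2"
begin

interpretation pair_graph G by (rule G)

interpretation H: pair_graph "EDC G" by (rule pair_graph_EDC) (rule G)

lemma diameter_2_cases:
  assumes "a \<in> pverts G" "b \<in> pverts G"
  shows "a = b \<or> (a, b) \<in> parcs G \<or> (\<exists>w. (a, w) \<in> parcs G \<and> (w, b) \<in> parcs G)"
proof (rule graph_dist_le_2_cases)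
  have "graph_dist G a b \<le> graph_diameter G"
    unfolding graph_diameter_def using assms by (intro SUP_upper2[of a] SUP_upper)
  then show "graph_dist G a b \<le> 2"
    using diam by (rule order_trans)
qed

lemma parcs_sym: "(a, b) \<in> parcs G \<longleftrightarrow> (b, a) \<in> parcs G"
  using arcs_symmetric by blast

lemma graph_dist_EDC_refl:
  assumes "x \<in> pverts (EDC G)"
  shows "graph_dist (EDC G) x x = 0"
  using H.graph_dist_eqI[of x "[]" x 0] assms by (simp add: H.awalk_simps)

lemma graph_dist_EDC_same_side:
  assumes ab: "a \<in> pverts G" "b \<in> pverts G" "a \<noteq> b"
  shows "graph_dist (EDC G) (Inl a) (Inl b) = 2" "graph_dist (EDC G) (Inr a) (Inr b) = 2"
proof -
  \<comment> \<open>\<open>w\<close> is a common neighbour of \<open>a\<close> and \<open>b\<close>,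
    or one of the two if they are adjacent. Equality is harmless because each vertex is adjacent to
    its own copy.\<close>
  obtain w where w: "w \<in> pverts G" "a = w \<or> (a, w) \<in> parcs G" "w = b \<or> (w, b) \<in> parcs G"
    using diameter_2_cases[OF ab(1,2)] ab(1,2) by (metis in_arcsD1 in_arcsD2)
  \<comment> \<open>The length is even, and it is nonzero since the end points differ.\<close>
  have "2 \<le> length q" if "H.awalk x q y" "isl x = isl y" "x \<noteq> y" for x y q
    using even_length_awalk_EDC[OF G that(1)] that
    by (cases q; cases "tl q") (auto simp: H.awalk_simps)
  then show "graph_dist (EDC G) (Inl a) (Inl b) = 2" "graph_dist (EDC G) (Inr a) (Inr b) = 2"
    using H.graph_dist_eqI[of "Inl a" "[(Inl a, Inr w), (Inr w, Inl b)]" "Inl b" 2]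
      H.graph_dist_eqI[of "Inr a" "[(Inr a, Inl w), (Inl w, Inr b)]" "Inr b" 2] w ab parcs_sym
    by (auto simp: H.awalk_simps parcs_EDC_iff) (auto simp: EDC_def)
qed

lemma graph_dist_EDC_cross:
  assumes ab: "a \<in> pverts G" "b \<in> pverts G"
  shows "graph_dist (EDC G) (Inl a) (Inr b) = (if a = b \<or> (a, b) \<in> parcs G then 1 else 3)"
    and "graph_dist (EDC G) (Inr b) (Inl a) = (if a = b \<or> (a, b) \<in> parcs G then 1 else 3)"
proof -
  have verts: "Inl a \<in> pverts (EDC G)" "Inr b \<in> pverts (EDC G)"
    using ab by (auto simp: EDC_def)
  have odd: "odd (length q)" if "H.awalk x q y" "isl x \<noteq> isl y" for x y q
    using even_length_awalk_EDC[OF G that(1)] that by simp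
  have "graph_dist (EDC G) (Inl a) (Inr b) = (if a = b \<or> (a, b) \<in> parcs G then 1 else 3)
    \<and> graph_dist (EDC G) (Inr b) (Inl a) = (if a = b \<or> (a, b) \<in> parcs G then 1 else 3)"
  proof (cases "a = b \<or> (a, b) \<in> parcs G")
    case True
    have "1 \<le> length q" if "H.awalk x q y" "isl x \<noteq> isl y" for x y q
      using odd[OF that] by (cases q) auto
    then show ?thesis
      using H.graph_dist_eqI[of "Inl a" "[(Inl a, Inr b)]" "Inr b" 1]
        H.graph_dist_eqI[of "Inr b" "[(Inr b, Inl a)]" "Inl a" 1] True ab verts
      by (auto simp: H.awalk_simps parcs_EDC_iff)
  next
    case False
    \<comment> \<open>The path through \<open>w\<close> lifts to a walk of length 3 that uses the
      edge between \<open>w\<close> and its copy as its middle step.\<close>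
    then obtain w where w: "(a, w) \<in> parcs G" "(w, b) \<in> parcs G"
      using diameter_2_cases[OF ab] by blast
    have wV: "w \<in> pverts G"
      using w by (auto dest: in_arcsD1)
    \<comment> \<open>The length is odd by parity and differs from 1 by non-adjacency.\<close>
    have 3: "3 \<le> length q" if q: "H.awalk x q y" "isl x \<noteq> isl y" "(x, y) \<notin> parcs (EDC G)" for x y q
    proof -
      have "length q \<noteq> 1"
      proof
        assume "length q = 1"
        then obtain e where "q = [e]"
          by (cases q) auto
        with q show False
          by (cases e) (auto simp: H.awalk_simps)
      qed
      with odd[OF q(1,2)] show ?thesis
        by (cases "length q"; cases "length q - 1"; cases "length q - 2") auto
    qed
    have "(Inl a, Inr b) \<notin> parcs (EDC G)" "(Inr b, Inl a) \<notin> parcs (EDC G)"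
      using False by (auto simp: parcs_EDC_iff)
    note lower = 3[OF _ _ this(1)] 3[OF _ _ this(2)]
    show ?thesis
      using H.graph_dist_eqI[of "Inl a" "[(Inl a, Inr w), (Inr w, Inl w), (Inl w, Inr b)]" "Inr b" 3]
        H.graph_dist_eqI[of "Inr b" "[(Inr b, Inl w), (Inl w, Inr w), (Inr w, Inl a)]" "Inl a" 3]
        False w wV verts lower
      by (auto simp: H.awalk_simps parcs_EDC_iff)
  qed
  then show "graph_dist (EDC G) (Inl a) (Inr b) = (if a = b \<or> (a, b) \<in> parcs G then 1 else 3)"
    and "graph_dist (EDC G) (Inr b) (Inl a) = (if a = b \<or> (a, b) \<in> parcs G then 1 else 3)"
    by blast+
qed

text \<open>Off the diagonal the entry for distance d is 1 - 2d. Distance 2 gives -3 within a side,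
  and distances 1 and 3 give -1 and -5 across. Listing both sides in the same order puts the pairs
  of a vertex and its copy on the diagonals of the off-diagonal blocks.\<close>

lemma distance_Seidel_mat_EDC:
  assumes vs: "enumerates vs G" and n: "n = length vs" and A: "A = adjacency_mat G vs"
  shows "distance_Seidel_mat (EDC G) (map Inl vs @ map Inr vs)
    = four_block_mat
        (mat n n (\<lambda>(i, j). (if i = j then 3 else 0) - 3))
        (mat n n (\<lambda>(i, j). (if i = j then 4 else 0) + 4 * A $$ (i, j) - 5))
        (mat n n (\<lambda>(i, j). (if i = j then 4 else 0) + 4 * A $$ (i, j) - 5))
        (mat n n (\<lambda>(i, j). (if i = j then 3 else 0) - 3))"
    (is "?L = ?R")
proof (rule eq_matI)
  have mem: "vs ! i \<in> pverts G" if "i < n" for i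
    using vs that nth_mem[of i vs] unfolding enumerates_def n by simp
  have neq: "vs ! i \<noteq> vs ! j" if "i < n" "j < n" "i \<noteq> j" for i j
    using vs that by (auto simp: enumerates_def n nth_eq_iff_index_eq)
  \<comment> \<open>Without loops \<open>A\<close> vanishes on its diagonal, so the cross entry
    there is 4 - 5 = -1, as distance 1 requires.\<close>
  have noloop: "(x, x) \<notin> parcs G" for x
    using pair_no_loops by fastforce
  have Aij: "A $$ (i, j) = (if (vs ! i, vs ! j) \<in> parcs G then 1 else 0)" if "i < n" "j < n" for i j
    using that by (simp add: A adjacency_mat_def n)
  have V: "Inl (vs ! i) \<in> pverts (EDC G)" "Inr (vs ! i) \<in> pverts (EDC G)" if "i < n" for i
    using mem[OF that] by (auto simp: EDC_def)
  fix i j assume "i < dim_row ?R" "j < dim_col ?R"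
  then have ij: "i < n + n" "j < n + n"
    by auto
  show "?L $$ (i, j) = ?R $$ (i, j)"
  proof (cases "i < n"; cases "j < n")
    assume "i < n" "j < n"
    then show ?thesis
      using mem neq V
      by (cases "i = j") (simp_all add: distance_Seidel_mat_def distance_mat_def nth_append
        graph_dist_EDC_refl graph_dist_EDC_same_side n[symmetric])
  next
    assume "i < n" "\<not> j < n"
    then show ?thesis
      using mem[of i] mem[of "j - n"] neq[of i "j - n"] ij noloop
      by (cases "i = j - n") (auto simp add: distance_Seidel_mat_def distance_mat_def nth_append
        graph_dist_EDC_cross n[symmetric] Aij)
  next
    assume "\<not> i < n" "j < n"
    then show ?thesis
      using mem[of j] mem[of "i - n"] neq[of j "i - n"] ij noloop parcs_sym
      by (cases "j = i - n") (auto simp add: distance_Seidel_mat_def distance_mat_def nth_append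
        graph_dist_EDC_cross n[symmetric] Aij)
  next
    assume "\<not> i < n" "\<not> j < n"
    then show ?thesis
      using mem[of "i - n"] mem[of "j - n"] neq[of "i - n" "j - n"] V[of "i - n"] ij
      by (cases "i = j") (auto simp add: distance_Seidel_mat_def distance_mat_def nth_append
        graph_dist_EDC_refl graph_dist_EDC_same_side n[symmetric])
  qed
qed (auto simp: distance_Seidel_mat_def distance_mat_def n)

end

section \<open>Independence of the vertex listing, and row sums\<close>

text \<open>This is the form that reordering requires: distinctness turns the index test in the
  identity matrix into a test on vertices.\<close>

lemma distance_Seidel_mat_conv:
  assumes "distinct xs"
  shows "distance_Seidel_mat G xs = mat (length xs) (length xs) (\<lambda>(i, j).
    (\<lambda>u v. 1 - (if u = v then 1 else 0) - 2 * real_of_ereal (graph_dist G u v)) (xs ! i) (xs ! j))"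
  using assms
  by (intro eq_matI) (auto simp: distance_Seidel_mat_def distance_mat_def nth_eq_iff_index_eq)

lemma eigenvalues_distance_Seidel_mat_reorder:
  assumes "enumerates xs G" "enumerates ys G"
  shows "eigenvalues (distance_Seidel_mat G xs) = eigenvalues (distance_Seidel_mat G ys)"
  using assms char_poly_mat_reorder[of xs ys
      "\<lambda>u v. 1 - (if u = v then 1 else 0) - 2 * real_of_ereal (graph_dist G u v)"]
  by (simp add: enumerates_def eigenvalues_def distance_Seidel_mat_conv)

lemma adjacency_mat_row_sum:
  assumes "pair_graph G" "regular_graph k G" "enumerates vs G" "i < length vs"
  shows "(\<Sum>j<length vs. adjacency_mat G vs $$ (i, j)) = real k"
proof -
  interpret pair_graph G by fact
  let ?u = "vs ! i"
  have vs: "distinct vs" "set vs = pverts G"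
    using assms(3) by (auto simp: enumerates_def)
  have "(\<Sum>j<length vs. adjacency_mat G vs $$ (i, j))
      = (\<Sum>j<length vs. if (?u, vs ! j) \<in> parcs G then 1 else 0)"
    using assms(4) by (intro sum.cong) (auto simp: adjacency_mat_def)
  also have "\<dots> = (\<Sum>v\<in>set vs. if (?u, v) \<in> parcs G then 1 else 0)"
    using bij_betw_nth[OF vs(1) refl refl] by (rule sum.reindex_bij_betw)
  also have "\<dots> = real (card {v \<in> set vs. (?u, v) \<in> parcs G})"
    by (simp add: sum.If_cases Int_def)
  \<comment> \<open>Out-neighbours correspond to outgoing arcs, since arcs with the same tail are
    determined by their heads.\<close>
  also have "{v \<in> set vs. (?u, v) \<in> parcs G} = snd ` out_arcs (with_proj G) ?u"
    using vs by (force dest: in_arcsD2 simp: image_iff)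
  also have "card \<dots> = out_degree (with_proj G) ?u"
    unfolding out_degree_def by (intro card_image inj_onI) (auto simp: prod_eq_iff)
  also have "\<dots> = k"
    using assms vs by (auto simp: regular_graph_def)
  finally show ?thesis .
qed

section \<open>The spectrum of the extended double cover\<close>

theorem theorem6p6:
  fixes G :: "'a pair_pre_digraph"
    and k n :: nat
    and ev :: "nat \<Rightarrow> real"
    and vs :: "'a list"
    and ws :: "('a + 'a) list"
  assumes "pair_graph G"
    and "Digraph_Component.connected (with_proj G)"
    and "regular_graph k G"
    and "card (pverts G) = n"
    and "graph_diameter G = 2"
    and "enumerates vs G"
    and "eigenvalues (adjacency_mat G vs) = image_mset ev (mset_set {1..n})"
    and "ev 1 = real k"
    and "\<And>i j. 1 \<le> i \<Longrightarrow> i \<le> j \<Longrightarrow> j \<le> n \<Longrightarrow> ev j \<le> ev i"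
    and "enumerates ws (EDC G)"
  shows "eigenvalues (distance_Seidel_mat (EDC G) ws) =
      {# - 8 * real n + 4 * real k + 7, 2 * real n - 4 * real k - 1 #}
      + image_mset (\<lambda>r. 7 + 4 * ev r) (mset_set {2..n})
      + image_mset (\<lambda>r. - 1 - 4 * ev r) (mset_set {2..n})"
proof -
  define A where "A = adjacency_mat G vs"
  have len: "length vs = n"
    using assms(4,6) by (auto simp: enumerates_def distinct_card[symmetric])
  have A: "A \<in> carrier_mat n n"
    by (simp add: A_def adjacency_mat_def len)
  \<comment> \<open>The supremum over an empty vertex set is minus infinity, not 2. Hence index 1
    exists and can be split off from \<open>{1..n}\<close>.\<close>
  have "pverts G \<noteq> {}"
    using assms(5) by (auto simp: graph_diameter_def bot_ereal_def)
  moreover have "finite (pverts G)"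
    using assms(1) by (simp add: pair_graph_def pair_digraph_def pair_fin_digraph.pair_finite_verts)
  ultimately have "n > 0"
    using assms(4) by auto
  then have I: "{1..n} = insert 1 {2..n}"
    by auto
  have ev: "proots (char_poly A) = image_mset ev (mset_set {1..n})"
    using assms(7) by (simp add: A_def eigenvalues_def)
  \<comment> \<open>The assumed multiset has n elements, which is the degree of
    \<open>char_poly A\<close>.\<close>
  have "char_poly A = (\<Prod>x\<in>#proots (char_poly A). [:- x, 1:])"
    using degree_monic_char_poly[OF A] by (intro eq_prod_proots) (auto simp: ev)
  also have "\<dots> = (\<Prod>r\<in>{1..n}. [:- ev r, 1:])"
    unfolding ev by (simp add: prod_unfold_prod_mset image_mset.compositionality comp_def)
  also have "\<dots> = [:- real k, 1:] * (\<Prod>r\<in>{2..n}. [:- ev r, 1:])"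
    unfolding I using assms(8) by simp
  finally have cpA: "char_poly A = [:- real k, 1:] * (\<Prod>r\<in>{2..n}. [:- ev r, 1:])" .
  have rows: "(\<Sum>j<n. A $$ (i, j)) = real k" if "i < n" for i
    using adjacency_mat_row_sum[OF assms(1,3,6)] that by (simp add: A_def len)
  note cp = char_poly_const_row_sum[OF A rows cpA finite_atLeastAtMost _ refl]

  \<comment> \<open>Roots of a product add up as multisets only if the product is nonzero.\<close>
  have nz: "[:- x, 1:] * (\<Prod>r\<in>{2..n}. [:- f r, 1:]) \<noteq> 0" for x :: real and f
    by (simp del: mult_pCons_left)
  have pr: "proots ([:- x, 1:] * (\<Prod>r\<in>{2..n}. [:- f r, 1:]))
      = {# x #} + image_mset f (mset_set {2..n})"
    for x :: real and f
    by (subst proots_mult) (simp_all add: proots_prod_linear del: mult_pCons_left)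
  let ?us = "map Inl vs @ map Inr vs"
  let ?P = "mat n n (\<lambda>(i, j). (if i = j then 3 else 0) - 3 :: real)"
  let ?Q = "mat n n (\<lambda>(i, j). (if i = j then 4 else 0) + 4 * A $$ (i, j) - 5)"
  have "enumerates ?us (EDC G)"
    using assms(6) by (auto simp: enumerates_def EDC_def distinct_map)
  then have "eigenvalues (distance_Seidel_mat (EDC G) ws)
      = eigenvalues (distance_Seidel_mat (EDC G) ?us)"
    using assms(10) by (intro eigenvalues_distance_Seidel_mat_reorder)
  also have "\<dots> = proots (char_poly (?P + ?Q) * char_poly (?P - ?Q))"
    using assms(1,5,6) unfolding eigenvalues_def
    by (subst distance_Seidel_mat_EDC[OF _ _ _ len[symmetric] A_def])
      (auto simp: char_poly_four_block_mat_swap[of _ n])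
  \<comment> \<open>The constants are 7 = 3 + 4 and -8 = -3 - 5. For the difference they are -1 = 3
    - 4 and 2 = -3 + 5.\<close>
  also have "?P + ?Q = mat n n (\<lambda>(i, j). (if i = j then 7 else 0) + 4 * A $$ (i, j) + (- 8))"
    by (rule eq_matI) auto
  also have "char_poly \<dots> = [:- (7 + 4 * real k + - 8 * real n), 1:]
      * (\<Prod>r\<in>{2..n}. [:- (7 + 4 * ev r), 1:])"
    by (rule cp) simp_all
  also have "?P - ?Q = mat n n (\<lambda>(i, j). (if i = j then - 1 else 0) + (- 4) * A $$ (i, j) + 2)"
    by (rule eq_matI) auto
  also have "char_poly \<dots> = [:- (- 1 + - 4 * real k + 2 * real n), 1:]
      * (\<Prod>r\<in>{2..n}. [:- (- 1 + - 4 * ev r), 1:])"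
    by (rule cp) simp_all
  finally have "eigenvalues (distance_Seidel_mat (EDC G) ws)
    = {# 7 + 4 * real k + - 8 * real n #} + image_mset (\<lambda>r. 7 + 4 * ev r) (mset_set {2..n})
      + ({# - 1 + - 4 * real k + 2 * real n #} + image_mset (\<lambda>r. - 1 + - 4 * ev r) (mset_set {2..n}))"
    by (subst (asm) proots_mult) (simp_all only: nz pr not_False_eq_True)
  then show ?thesis
    by (simp add: algebra_simps)
qed

end
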